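(* Let $\mathcal{P}=\{f_1,\ldots,f_n\}\subset\mathbb{D}\{U\}$ be a system of linear differential polynomials satisfying the standing assumptions $(\mathcal{P}1)$–$(\mathcal{P}4)$. Then $\mathcal{P}$ is differentially essential if and only if $\mathcal{P}$ has a unique super essential subsystem.
   Context: Let $\mathbb{D}$ be an ordinary differential domain with derivation $\partial$, $n\ge 2$, and $U=\{u_1,\ldots,u_{n-1}\}$ a set of differential indeterminates over $\mathbb{D}$; $\mathbb{D}\{U\}$ is the ring of differential polynomials and $\mathbb{D}[\partial]$ the ring of linear differential operators with coefficients in $\mathbb{D}$. System: $\mathcal{P}=\{f_1,\ldots,f_n\}$ with $f_i=a_i+\sum_{j=1}^{n-1}\mathcal{L}_{i,j}(u_j)$, $a_i\in\mathbb{D}$, $\mathcal{L}_{i,j}\in\mathbb{D}[\partial]$. Standing assumptions: $(\mathcal{P}1)$ every $f_i$ has order $\ge 0$ in $U$ (i.e. $f_i\notin\mathbb{D}$); $(\mathcal{P}2)$ the $n$ polynomials are distinct; $(\mathcal{P}3)$ $a_i\neq0$ for some $i$; $(\mathcal{P}4)$ for every $j\in\{1,\ldots,n-1\}$ there is $i$ with $\mathcal{L}_{i,j}\neq0$. For $i\in\{1,\ldots,n\}$ consider the condition $(\tau)_i$: there is a permutation $\tau_i$ of $\{1,\ldots,n-1\}$ such that $\mathcal{L}_{j,\tau_i(n-j)}\neq 0$ for $j=1,\ldots,i-1$ and $\mathcal{L}_{j,\tau_i(n-j+1)}\neq 0$ for $j=i+1,\ldots,n$. The system $\mathcal{P}$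 is differentially essential if $(\tau)_i$ holds for at least one $i$, and super essential if $(\tau)_i$ holds for every $i\in\{1,\ldots,n\}$. A subsystem (subset) $\mathcal{P}'=\{f_{i_1},\ldots,f_{i_m}\}$ of $\mathcal{P}$ (possibly $\mathcal{P}$ itself) is super essential if there is $J\subset\{1,\ldots,n-1\}$ with $|J|=m-1$ such that $\mathcal{L}_{i_h,j}=0$ for all $h$ and all $j\notin J$, and for every $h\in\{1,\ldots,m\}$ there is a bijection $\eta:\{1,\ldots,m\}\setminus\{h\}\to J$ with $\mathcal{L}_{i_t,\eta(t)}\neq0$ for all $t\neq h$ (i.e. $\mathcal{P}'$ is super essential as a system of $m$ polynomials in the $m-1$ indeterminates $u_j$, $j\in J$). *)

theory Defs
  imports "HOL-Library.Poly_Mapping" "HOL-Combinatorics.Permutations"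
begin

definition is_derivation :: "('a::comm_ring_1 \<Rightarrow> 'a) \<Rightarrow> bool" where
  "is_derivation d \<longleftrightarrow>
     (\<forall>x y. d (x + y) = d x + d y) \<and> (\<forall>x y. d (x * y) = d x * y + x * d y)"

text \<open>Differential polynomials: the algebraic indeterminate indexed by the pair \<open>(j, k)\<close> is the
  \<open>k\<close>-th derivative of \<open>u\<^sub>j\<close>.  A differential polynomial maps each monomial (a finitely supported
  exponent function) to its coefficient.\<close>

type_synonym dmonom = "(nat \<times> nat) \<Rightarrow>\<^sub>0 nat"
type_synonym 'a dpoly = "dmonom \<Rightarrow>\<^sub>0 'a"

definition dconst :: "'a::comm_ring_1 \<Rightarrow> 'a dpoly" where
  "dconst c = Poly_Mapping.single 0 c"

definition dvar :: "nat \<Rightarrow> nat \<Rightarrow> 'a::comm_ring_1 dpoly" where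
  "dvar j k = Poly_Mapping.single (Poly_Mapping.single (j, k) 1) 1"

text \<open>The derivation of the coefficient ring is extended by sending \<open>(j, k)\<close> to \<open>(j, k + 1)\<close>; on a
  monomial this is the product rule, on a term \<open>c m\<close> it is \<open>c' m + c m'\<close>.\<close>

definition dmonom_deriv :: "dmonom \<Rightarrow> 'a::comm_ring_1 dpoly" where
  "dmonom_deriv m =
     (\<Sum>v\<in>Poly_Mapping.keys m.
        Poly_Mapping.single
          (m - Poly_Mapping.single v 1 + Poly_Mapping.single (fst v, Suc (snd v)) 1)
          (of_nat (Poly_Mapping.lookup m v)))"

definition dpoly_deriv :: "('a::comm_ring_1 \<Rightarrow> 'a) \<Rightarrow> 'a dpoly \<Rightarrow> 'a dpoly" where
  "dpoly_deriv d p =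
     (\<Sum>m\<in>Poly_Mapping.keys p.
        Poly_Mapping.single m (d (Poly_Mapping.lookup p m))
        + dconst (Poly_Mapping.lookup p m) * dmonom_deriv m)"

text \<open>A linear differential operator \<open>\<Sum>k. c\<^sub>k \<partial>\<^sup>k\<close> is given by its finitely many nonzero coefficients
  \<open>c\<^sub>k\<close>.  Only its action and its being zero matter below; the (commutative) convolution
  product that this type carries is not composition of operators and is never used.\<close>

type_synonym 'a diff_operator = "nat \<Rightarrow>\<^sub>0 'a"

definition apply_operator ::
    "('a::comm_ring_1 \<Rightarrow> 'a) \<Rightarrow> 'a diff_operator \<Rightarrow> 'a dpoly \<Rightarrow> 'a dpoly" where
  "apply_operator d L p =
     (\<Sum>k\<in>Poly_Mapping.keys L. dconst (Poly_Mapping.lookup L k) * (dpoly_deriv d ^^ k) p)"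

definition linear_dpoly ::
    "('a::comm_ring_1 \<Rightarrow> 'a) \<Rightarrow> nat \<Rightarrow> 'a \<Rightarrow> (nat \<Rightarrow> 'a diff_operator) \<Rightarrow> 'a dpoly" where
  "linear_dpoly d n a L = dconst a + (\<Sum>j=1..n-1. apply_operator d (L j) (dvar j 0))"

definition tau_condition :: "nat \<Rightarrow> (nat \<Rightarrow> nat \<Rightarrow> 'a::zero diff_operator) \<Rightarrow> nat \<Rightarrow> bool" where
  "tau_condition n L i \<longleftrightarrow>
     (\<exists>\<tau>. \<tau> permutes {1..n-1} \<and>
          (\<forall>j\<in>{1..<i}. L j (\<tau> (n - j)) \<noteq> 0) \<and>
          (\<forall>j\<in>{i+1..n}. L j (\<tau> (n - j + 1)) \<noteq> 0))"

definition differentially_essential ::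
    "nat \<Rightarrow> (nat \<Rightarrow> nat \<Rightarrow> 'a::zero diff_operator) \<Rightarrow> bool" where
  "differentially_essential n L \<longleftrightarrow> (\<exists>i\<in>{1..n}. tau_condition n L i)"

text \<open>A subsystem is a set \<open>Q\<close> of polynomials of the system \<open>f\<^sub>1, \<dots>, f\<^sub>n\<close>, listed by an index set
  \<open>I\<close>; for pairwise distinct \<open>f\<^sub>i\<close> the set \<open>I\<close> is determined by \<open>Q\<close> and \<open>card I = card Q\<close>.
  Writing \<open>|J| = |I| - 1\<close> as \<open>card I = card J + 1\<close> excludes \<open>I = {}\<close>, which truncated
  subtraction would admit.\<close>

definition super_essential_subsystem ::
    "nat \<Rightarrow> (nat \<Rightarrow> 'a::zero dpoly) \<Rightarrow> (nat \<Rightarrow> nat \<Rightarrow> 'a diff_operator) \<Rightarrow> 'a dpoly set \<Rightarrow> bool" where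
  "super_essential_subsystem n f L Q \<longleftrightarrow>
     (\<exists>I J. I \<subseteq> {1..n} \<and> Q = f ` I \<and> J \<subseteq> {1..n-1} \<and> card I = card J + 1 \<and>
        (\<forall>i\<in>I. \<forall>j\<in>{1..n-1} - J. L i j = 0) \<and>
        (\<forall>h\<in>I. \<exists>\<eta>. bij_betw \<eta> (I - {h}) J \<and> (\<forall>t\<in>I - {h}. L t (\<eta> t) \<noteq> 0)))"

text \<open>Sanity check: the extended derivation does send each derivative of \<open>u\<^sub>j\<close> to the next one.\<close>

lemma is_derivation_one: "is_derivation d \<Longrightarrow> d 1 = 0"
  unfolding is_derivation_def by (metis add_cancel_right_right mult.left_neutral mult.right_neutral)

lemma dpoly_deriv_dvar:
  assumes "is_derivation d"
  shows "dpoly_deriv d (dvar j k) = dvar j (Suc k)"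
  by (simp add: dpoly_deriv_def dvar_def dmonom_deriv_def dconst_def
      is_derivation_one[OF assms] mult_single)

lemma dpoly_deriv_funpow_dvar:
  assumes "is_derivation d"
  shows "(dpoly_deriv d ^^ i) (dvar j k) = dvar j (k + i)"
  by (induction i) (simp_all add: dpoly_deriv_dvar[OF assms])

end

theory Submission imports Defs begin

text \<open>Only the bipartite graph joining the row \<open>i\<close> to the columns \<open>j\<close> with \<open>L i j \<noteq> 0\<close> matters.
  By Hall's theorem the super essential subsystems are exactly the inclusion-minimal sets of rows
  having fewer neighbours than elements.  Such a set always exists, as there are \<open>n\<close> rows and \<open>n - 1\<close>
  columns.  If all rows but one can be matched, a set of \<open>k\<close> rows has at least \<open>k - 1\<close>
  neighbours; submodularity of the number of neighbours then forbids two different minimal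
  deficient sets.  Conversely, if the minimal deficient set is unique, then removing any one of its
  rows leaves a system without deficient sets, which Hall's theorem matches to all the columns.\<close>

section \<open>Hall's marriage theorem\<close>

text \<open>Induction on \<open>A\<close>. If some nonempty proper subset is tight, it is matched
  first and the other rows are matched outside its neighbours. Otherwise every such subset has a
  spare neighbour, so any one pair can be matched and removed.\<close>

lemma hall_marriage:
  fixes N :: "'a \<Rightarrow> 'b set"
  assumes "finite A" and "\<And>i. i \<in> A \<Longrightarrow> finite (N i)"
    and "\<And>X. X \<subseteq> A \<Longrightarrow> card X \<le> card (\<Union>(N ` X))"
  shows "\<exists>\<eta>. inj_on \<eta> A \<and> (\<forall>i\<in>A. \<eta> i \<in> N i)"
  using assms
proof (induction A arbitrary: N rule: finite_psubset_induct)
  case (psubset A)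
  note fin = \<open>finite A\<close> and finN = psubset.prems(1) and hall = psubset.prems(2)
  show ?case
  proof (cases "\<exists>X. X \<noteq> {} \<and> X \<subset> A \<and> card (\<Union>(N ` X)) \<le> card X")
    case True
    then obtain X where X: "X \<noteq> {}" "X \<subset> A" "card (\<Union>(N ` X)) \<le> card X" by blast
    have finX: "finite X" using X fin by (auto intro: finite_subset)
    have "\<exists>\<eta>. inj_on \<eta> X \<and> (\<forall>i\<in>X. \<eta> i \<in> N i)"
    proof (rule psubset.IH[OF X(2)])
      show "finite (N i)" if "i \<in> X" for i using that X(2) finN by blast
      show "card Y \<le> card (\<Union>(N ` Y))" if "Y \<subseteq> X" for Y using that X(2) by (intro hall) blast
    qed
    then obtain \<eta> where \<eta>: "inj_on \<eta> X" "\<And>i. i \<in> X \<Longrightarrow> \<eta> i \<in> N i" by blast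
    \<comment> \<open>Deleting the neighbours of \<open>X\<close> keeps the two partial matchings
      from colliding.\<close>
    define N' where "N' = (\<lambda>i. N i - \<Union>(N ` X))"
    have "\<exists>\<eta>'. inj_on \<eta>' (A - X) \<and> (\<forall>i\<in>A - X. \<eta>' i \<in> N' i)"
    proof (rule psubset.IH)
      show "A - X \<subset> A" using X by blast
      show "finite (N' i)" if "i \<in> A - X" for i using that finN by (simp add: N'_def)
      fix Y assume Y: "Y \<subseteq> A - X"
      have finY: "finite Y" using Y fin by (auto intro: finite_subset)
      \<comment> \<open>Hall's condition for \<open>X \<union> Y\<close> gives it for
        \<open>Y\<close> under \<open>N'\<close>, because the tight set \<open>X\<close> uses up at
        most \<open>card X\<close> neighbours.\<close>
      have "card X + card Y = card (X \<union> Y)"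
        using Y finX finY by (subst card_Un_disjoint) auto
      also have "\<dots> \<le> card (\<Union>(N ` (X \<union> Y)))" using X Y by (intro hall) auto
      also have "\<Union>(N ` (X \<union> Y)) = \<Union>(N ` X) \<union> \<Union>(N' ` Y)" by (auto simp: N'_def)
      also have "card \<dots> \<le> card (\<Union>(N ` X)) + card (\<Union>(N' ` Y))" by (rule card_Un_le)
      finally show "card Y \<le> card (\<Union>(N' ` Y))" using X(3) by linarith
    qed
    then obtain \<eta>' where \<eta>': "inj_on \<eta>' (A - X)" "\<And>i. i \<in> A - X \<Longrightarrow> \<eta>' i \<in> N' i" by blast
    let ?\<theta> = "\<lambda>i. if i \<in> X then \<eta> i else \<eta>' i"
    have "inj_on ?\<theta> A"
    proof (rule inj_onI)
      fix x y assume xy: "x \<in> A" "y \<in> A" "?\<theta> x = ?\<theta> y"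
      have sep: "\<eta> u \<noteq> \<eta>' v" if "u \<in> X" "v \<in> A - X" for u v
        using \<eta>(2)[OF that(1)] \<eta>'(2)[OF that(2)] that(1) by (auto simp: N'_def)
      show "x = y"
        using xy sep[of x y] sep[of y x] inj_onD[OF \<eta>(1), of x y] inj_onD[OF \<eta>'(1), of x y]
        by (cases "x \<in> X"; cases "y \<in> X") simp_all
    qed
    moreover have "\<forall>i\<in>A. ?\<theta> i \<in> N i" using \<eta>(2) \<eta>'(2) by (auto simp: N'_def)
    ultimately show ?thesis by blast
  next
    case no_tight: False
    show ?thesis
    proof (cases "A = {}")
      case True
      then show ?thesis by simp
    next
      case nonempty: False
      then obtain a where a: "a \<in> A" by blast
      have "N a \<noteq> {}" using hall[of "{a}"] a by auto
      then obtain b where b: "b \<in> N a" by blast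
      have "\<exists>\<eta>. inj_on \<eta> (A - {a}) \<and> (\<forall>i\<in>A - {a}. \<eta> i \<in> N i - {b})"
      proof (rule psubset.IH)
        show "A - {a} \<subset> A" using a by blast
        show "finite (N i - {b})" if "i \<in> A - {a}" for i using that finN by simp
        fix Y assume Y: "Y \<subseteq> A - {a}"
        have eq: "(\<Union>i\<in>Y. N i - {b}) = \<Union>(N ` Y) - {b}" by blast
        show "card Y \<le> card (\<Union>i\<in>Y. N i - {b})"
        proof (cases "Y = {}")
          case True
          then show ?thesis by simp
        next
          case False
          moreover have "Y \<subset> A" using Y a by blast
          \<comment> \<open>Without tight sets the inequality is strict, so \<open>Y\<close> can
            afford to lose \<open>b\<close>.\<close>
          ultimately have "card Y < card (\<Union>(N ` Y))" using no_tight not_le by blast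
          moreover have "card (\<Union>(N ` Y)) - 1 \<le> card (\<Union>(N ` Y) - {b})"
            using card_Diff_singleton_if by (metis diff_le_self order_refl)
          ultimately show ?thesis unfolding eq by linarith
        qed
      qed
      then obtain \<eta> where \<eta>: "inj_on \<eta> (A - {a})" "\<And>i. i \<in> A - {a} \<Longrightarrow> \<eta> i \<in> N i - {b}" by blast
      have "inj_on (\<eta>(a := b)) A"
        using \<eta> by (auto simp: inj_on_def)
      moreover have "\<forall>i\<in>A. (\<eta>(a := b)) i \<in> N i" using \<eta>(2) b by auto
      ultimately show ?thesis by blast
    qed
  qed
qed

section \<open>Minimal deficient sets\<close>

text \<open>In a finite graph these are, by Hall's theorem, the circuits of the transversal matroid
  on the rows. The strict inequality also makes \<open>I\<close> finite and nonempty, as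
  \<open>card\<close> is 0 on infinite sets.\<close>

definition minimal_deficient :: "('a \<Rightarrow> 'b set) \<Rightarrow> 'a set \<Rightarrow> bool" where
  "minimal_deficient N I \<longleftrightarrow>
     card (\<Union>(N ` I)) < card I \<and> (\<forall>X. X \<subset> I \<longrightarrow> card X \<le> card (\<Union>(N ` X)))"

lemma deficient_imp_minimal_deficient:
  assumes "finite A" "card (\<Union>(N ` A)) < card A"
  shows "\<exists>I\<subseteq>A. minimal_deficient N I"
  using assms
proof (induction A rule: finite_psubset_induct)
  case (psubset A)
  show ?case
  proof (cases "\<exists>X. X \<subset> A \<and> card (\<Union>(N ` X)) < card X")
    case True
    then obtain X where X: "X \<subset> A" "card (\<Union>(N ` X)) < card X" by blast
    from psubset.IH[OF X] X(1) show ?thesis by (meson psubset_imp_subset subset_trans)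
  next
    case False
    then have "minimal_deficient N A"
      using psubset.prems unfolding minimal_deficient_def not_less[symmetric] by blast
    then show ?thesis by blast
  qed
qed

text \<open>If the two sets differ, their intersection is a proper subset of one of them and so is
  not deficient. Each set has deficiency at least 1, so their union has deficiency at least 2, which
  \<open>nullity\<close> excludes.\<close>

lemma minimal_deficient_unique:
  fixes N :: "'a \<Rightarrow> 'b set"
  assumes fin: "finite (I1 \<union> I2)" "finite (\<Union>(N ` (I1 \<union> I2)))"
    and min: "minimal_deficient N I1" "minimal_deficient N I2"
    and nullity: "card (I1 \<union> I2) \<le> card (\<Union>(N ` (I1 \<union> I2))) + 1"
  shows "I1 = I2"
proof (rule ccontr)
  assume "I1 \<noteq> I2"
  then have "I1 \<inter> I2 \<subset> I1 \<or> I1 \<inter> I2 \<subset> I2" by blast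
  with min have "card (I1 \<inter> I2) \<le> card (\<Union>(N ` (I1 \<inter> I2)))"
    unfolding minimal_deficient_def by blast
  \<comment> \<open>A common neighbour need not come from a common row, so this is only an
    inclusion; it is what makes the count submodular.\<close>
  also have "\<dots> \<le> card (\<Union>(N ` I1) \<inter> \<Union>(N ` I2))"
    using fin(2) by (intro card_mono) auto
  finally have inter: "card (I1 \<inter> I2) \<le> card (\<Union>(N ` I1) \<inter> \<Union>(N ` I2))" .
  have "card (\<Union>(N ` I1)) + card (\<Union>(N ` I2)) =
      card (\<Union>(N ` (I1 \<union> I2))) + card (\<Union>(N ` I1) \<inter> \<Union>(N ` I2))"
    using fin(2) card_Un_Int[of "\<Union>(N ` I1)" "\<Union>(N ` I2)"] by (simp add: image_Un)
  moreover have "card I1 + card I2 = card (I1 \<union> I2) + card (I1 \<inter> I2)"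
    using fin(1) by (intro card_Un_Int) simp_all
  ultimately show False
    using min inter nullity unfolding minimal_deficient_def by linarith
qed

section \<open>Super essential subsystems in the bipartite graph\<close>

text \<open>\<open>L\<close> is a total function, so its values outside the genuine columns are
  arbitrary and must be cut off.\<close>

definition neighbours :: "nat \<Rightarrow> (nat \<Rightarrow> nat \<Rightarrow> 'a::zero diff_operator) \<Rightarrow> nat \<Rightarrow> nat set" where
  "neighbours n L i = {j\<in>{1..n-1}. L i j \<noteq> 0}"

lemma Union_neighbours_subset: "\<Union>(neighbours n L ` X) \<subseteq> {1..n-1}"
  by (auto simp: neighbours_def)

lemma finite_neighbours [simp]: "finite (neighbours n L i)"
  by (simp add: neighbours_def)

lemma finite_Union_neighbours: "finite (\<Union>(neighbours n L ` X))"
  using Union_neighbours_subset by (rule finite_subset) simp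

text \<open>A matching of \<open>I - {h}\<close> gives Hall's condition for the subsets avoiding
  \<open>h\<close>; as \<open>h\<close> varies, these are all proper subsets of \<open>I\<close>.
  The size of \<open>J\<close> encodes deficiency one.\<close>

lemma super_essential_subsystem_iff:
  "super_essential_subsystem n f L Q \<longleftrightarrow>
     (\<exists>I\<subseteq>{1..n}. Q = f ` I \<and> minimal_deficient (neighbours n L) I)"
proof
  assume "super_essential_subsystem n f L Q"
  then obtain I J where I: "I \<subseteq> {1..n}" "Q = f ` I" and J: "J \<subseteq> {1..n-1}" "card I = card J + 1"
    and zero: "\<forall>i\<in>I. \<forall>j\<in>{1..n-1} - J. L i j = 0"
    and match: "\<forall>h\<in>I. \<exists>\<eta>. bij_betw \<eta> (I - {h}) J \<and> (\<forall>t\<in>I - {h}. L t (\<eta> t) \<noteq> 0)"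
    unfolding super_essential_subsystem_def by (elim exE conjE) (rule that)
  have "\<Union>(neighbours n L ` I) \<subseteq> J"
    using zero unfolding neighbours_def by blast
  then have "card (\<Union>(neighbours n L ` I)) \<le> card J"
    using J(1) by (intro card_mono) (auto intro: finite_subset)
  moreover have "card X \<le> card (\<Union>(neighbours n L ` X))" if "X \<subset> I" for X
  proof -
    from that obtain h where h: "h \<in> I" "X \<subseteq> I - {h}" by blast
    then obtain \<eta> where \<eta>: "bij_betw \<eta> (I - {h}) J" "\<forall>t\<in>I - {h}. L t (\<eta> t) \<noteq> 0"
      using match by blast
    have "inj_on \<eta> X"
      using \<eta>(1) h(2) by (meson bij_betw_imp_inj_on inj_on_subset)
    moreover have "\<eta> t \<in> neighbours n L t" if "t \<in> X" for t
      using that h(2) \<eta> J(1) bij_betwE[OF \<eta>(1)] unfolding neighbours_def by blast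
    ultimately show ?thesis
      by (intro card_inj_on_le[of \<eta>]) (auto simp: finite_Union_neighbours)
  qed
  ultimately have "minimal_deficient (neighbours n L) I"
    using J(2) by (simp add: minimal_deficient_def)
  with I show "\<exists>I\<subseteq>{1..n}. Q = f ` I \<and> minimal_deficient (neighbours n L) I" by blast
next
  assume "\<exists>I\<subseteq>{1..n}. Q = f ` I \<and> minimal_deficient (neighbours n L) I"
  then obtain I where I: "I \<subseteq> {1..n}" "Q = f ` I"
    and deficient: "card (\<Union>(neighbours n L ` I)) < card I"
    and hall: "\<And>X. X \<subset> I \<Longrightarrow> card X \<le> card (\<Union>(neighbours n L ` X))"
    unfolding minimal_deficient_def by blast
  \<comment> \<open>The columns that actually occur in the rows of \<open>I\<close>; all others
    vanish there.\<close>
  define J where "J = \<Union>(neighbours n L ` I)"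
  have finI: "finite I" using I(1) by (rule finite_subset) simp
  have finJ: "finite J" unfolding J_def by (rule finite_Union_neighbours)
  have card_le: "card (I - {h}) \<le> card J" if "h \<in> I" for h
  proof -
    have "card (I - {h}) \<le> card (\<Union>(neighbours n L ` (I - {h})))"
      using that by (intro hall) auto
    also have "\<dots> \<le> card J" using finJ unfolding J_def by (intro card_mono) auto
    finally show ?thesis .
  qed
  \<comment> \<open>Removing one row leaves a set that is not deficient, so the deficiency of
    \<open>I\<close> is exactly 1.\<close>
  have "I \<noteq> {}" using deficient by auto
  then obtain h0 where "h0 \<in> I" by blast
  then have cardI: "card I = card J + 1"
    using card_le[of h0] deficient finI by (simp add: J_def)
  have "\<exists>\<eta>. bij_betw \<eta> (I - {h}) J \<and> (\<forall>t\<in>I - {h}. L t (\<eta> t) \<noteq> 0)" if h: "h \<in> I" for h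
  proof -
    have "\<exists>\<eta>. inj_on \<eta> (I - {h}) \<and> (\<forall>t\<in>I - {h}. \<eta> t \<in> neighbours n L t)"
      using finI h by (intro hall_marriage) (auto intro!: hall)
    then obtain \<eta> where \<eta>: "inj_on \<eta> (I - {h})" "\<forall>t\<in>I - {h}. \<eta> t \<in> neighbours n L t" by blast
    have "\<eta> ` (I - {h}) = J"
    proof (rule card_subset_eq[OF finJ])
      show "\<eta> ` (I - {h}) \<subseteq> J" using \<eta>(2) by (auto simp: J_def)
      show "card (\<eta> ` (I - {h})) = card J" using \<eta>(1) h cardI finI by (simp add: card_image)
    qed
    with \<eta> show ?thesis by (auto simp: bij_betw_def neighbours_def)
  qed
  moreover have "\<forall>i\<in>I. \<forall>j\<in>{1..n-1} - J. L i j = 0"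
    by (auto simp: J_def neighbours_def)
  moreover have "J \<subseteq> {1..n-1}"
    unfolding J_def by (rule Union_neighbours_subset)
  ultimately show "super_essential_subsystem n f L Q"
    unfolding super_essential_subsystem_def using I cardI by (intro exI[of _ I] exI[of _ J] conjI) auto
qed

section \<open>Condition \<open>(\<tau>)\<^sub>i\<close> as a matching\<close>

text \<open>Condition \<open>(\<tau>)\<^sub>i\<close> requires \<open>L j (\<tau> (slot n i j)) \<noteq> 0\<close> for every row \<open>j \<noteq> i\<close>.\<close>

definition slot :: "nat \<Rightarrow> nat \<Rightarrow> nat \<Rightarrow> nat" where
  "slot n i j = (if j < i then n - j else n - j + 1)"

text \<open>The rows before \<open>i\<close> fill the slots \<open>n-i+1, ..., n-1\<close> and those
  after \<open>i\<close> fill \<open>1, ..., n-i\<close>. The witness inverse tells these ranges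
  apart by \<open>n < k + i\<close>, which avoids truncated subtraction.\<close>

lemma bij_betw_slot:
  assumes "i \<in> {1..n}"
  shows "bij_betw (slot n i) ({1..n} - {i}) {1..n-1}"
proof (rule bij_betw_byWitness[where f' = "\<lambda>k. if n < k + i then n - k else n - k + 1"])
  show "\<forall>j\<in>{1..n} - {i}. (if n < slot n i j + i then n - slot n i j else n - slot n i j + 1) = j"
  proof
    fix j assume "j \<in> {1..n} - {i}"
    with assms show "(if n < slot n i j + i then n - slot n i j else n - slot n i j + 1) = j"
      by (cases "j < i") (simp_all add: slot_def, arith+)
  qed
  show "\<forall>k\<in>{1..n-1}. slot n i (if n < k + i then n - k else n - k + 1) = k"
  proof
    fix k assume "k \<in> {1..n-1}"
    with assms show "slot n i (if n < k + i then n - k else n - k + 1) = k"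
      by (cases "n < k + i") (simp_all add: slot_def, arith+)
  qed
  show "slot n i ` ({1..n} - {i}) \<subseteq> {1..n-1}"
  proof (rule image_subsetI)
    fix j assume "j \<in> {1..n} - {i}"
    with assms show "slot n i j \<in> {1..n-1}"
      by (cases "j < i") (simp_all add: slot_def, arith+)
  qed
  show "(\<lambda>k. if n < k + i then n - k else n - k + 1) ` {1..n-1} \<subseteq> {1..n} - {i}"
  proof (rule image_subsetI)
    fix k assume "k \<in> {1..n-1}"
    with assms show "(if n < k + i then n - k else n - k + 1) \<in> {1..n} - {i}"
      by (cases "n < k + i") (simp_all, arith+)
  qed
qed

text \<open>The permutation merely renumbers a matching: \<open>\<tau>\<close> composed with
  \<open>slot n i\<close> is one, and a matching composed with the inverse of
  \<open>slot n i\<close> gives \<open>\<tau>\<close> back.\<close>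

lemma tau_condition_iff:
  assumes i: "i \<in> {1..n}"
  shows "tau_condition n L i \<longleftrightarrow>
    (\<exists>\<eta>. inj_on \<eta> ({1..n} - {i}) \<and> (\<forall>j\<in>{1..n} - {i}. \<eta> j \<in> neighbours n L j))"
proof
  let ?R = "{1..n} - {i}"
  assume "tau_condition n L i"
  then obtain \<tau> where \<tau>: "\<tau> permutes {1..n-1}"
    and nz1: "\<forall>j\<in>{1..<i}. L j (\<tau> (n - j)) \<noteq> 0"
    and nz2: "\<forall>j\<in>{i+1..n}. L j (\<tau> (n - j + 1)) \<noteq> 0"
    unfolding tau_condition_def by blast
  have bij: "bij_betw (\<tau> \<circ> slot n i) ?R {1..n-1}"
    using bij_betw_slot[OF i] permutes_imp_bij[OF \<tau>] by (rule bij_betw_trans)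
  have "(\<tau> \<circ> slot n i) j \<in> neighbours n L j" if j: "j \<in> ?R" for j
  proof -
    have "L j ((\<tau> \<circ> slot n i) j) \<noteq> 0"
      using j nz1 nz2 by (auto simp: slot_def)
    with bij_betwE[OF bij] j show ?thesis by (simp add: neighbours_def)
  qed
  with bij show "\<exists>\<eta>. inj_on \<eta> ?R \<and> (\<forall>j\<in>?R. \<eta> j \<in> neighbours n L j)"
    by (blast dest: bij_betw_imp_inj_on)
next
  let ?R = "{1..n} - {i}"
  assume "\<exists>\<eta>. inj_on \<eta> ?R \<and> (\<forall>j\<in>?R. \<eta> j \<in> neighbours n L j)"
  then obtain \<eta> where \<eta>: "inj_on \<eta> ?R" "\<And>j. j \<in> ?R \<Longrightarrow> \<eta> j \<in> neighbours n L j" by blast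
  \<comment> \<open>An injection of \<open>n - 1\<close> rows into \<open>n - 1\<close> columns is
    onto.\<close>
  have "\<eta> ` ?R = {1..n-1}"
  proof (rule card_subset_eq)
    show "\<eta> ` ?R \<subseteq> {1..n-1}" using \<eta>(2) unfolding neighbours_def by blast
    show "card (\<eta> ` ?R) = card {1..n-1}" using \<eta>(1) i by (simp add: card_image)
  qed simp
  with \<eta>(1) have bij: "bij_betw \<eta> ?R {1..n-1}" by (simp add: bij_betw_def)
  let ?s = "inv_into ?R (slot n i)"
  \<comment> \<open>The identity outside the columns is what \<open>permutes\<close>
    demands.\<close>
  define \<tau> where "\<tau> k = (if k \<in> {1..n-1} then \<eta> (?s k) else k)" for k
  have "bij_betw (\<eta> \<circ> ?s) {1..n-1} {1..n-1}"
    using bij_betw_inv_into[OF bij_betw_slot[OF i]] bij by (rule bij_betw_trans)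
  then have "bij_betw \<tau> {1..n-1} {1..n-1}"
    by (rule bij_betw_cong[THEN iffD1, rotated]) (simp add: \<tau>_def)
  then have "\<tau> permutes {1..n-1}"
    by (rule bij_imp_permutes) (auto simp: \<tau>_def)
  moreover have "L j (\<tau> (slot n i j)) \<noteq> 0" if j: "j \<in> ?R" for j
  proof -
    have "slot n i j \<in> {1..n-1}" using bij_betwE[OF bij_betw_slot[OF i]] j by blast
    moreover have "?s (slot n i j) = j"
      using bij_betw_slot[OF i] j by (rule bij_betw_inv_into_left)
    ultimately have "\<tau> (slot n i j) = \<eta> j" by (simp add: \<tau>_def)
    with \<eta>(2)[OF j] show ?thesis by (simp add: neighbours_def)
  qed
  then have "L j (\<tau> (n - j)) \<noteq> 0" if "j \<in> {1..<i}" for j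
    using that i by (force simp: slot_def)
  moreover have "L j (\<tau> (n - j + 1)) \<noteq> 0" if "j \<in> {i+1..n}" for j
    using that i \<open>\<And>j. j \<in> ?R \<Longrightarrow> L j (\<tau> (slot n i j)) \<noteq> 0\<close>[of j] by (simp add: slot_def)
  ultimately show "tau_condition n L i" unfolding tau_condition_def by blast
qed

section \<open>Differential essentiality and uniqueness\<close>

theorem theorem4p10:
  fixes d :: "'a::idom \<Rightarrow> 'a"
    and n :: nat
    and a :: "nat \<Rightarrow> 'a"
    and L :: "nat \<Rightarrow> nat \<Rightarrow> 'a diff_operator"
    and f :: "nat \<Rightarrow> 'a dpoly"
  assumes "is_derivation d"
    and "n \<ge> 2"
    and "\<And>i. i \<in> {1..n} \<Longrightarrow> f i = linear_dpoly d n (a i) (L i)"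
    and P1: "\<And>i. i \<in> {1..n} \<Longrightarrow> f i \<notin> range dconst"
    and P2: "inj_on f {1..n}"
    and P3: "\<exists>i\<in>{1..n}. a i \<noteq> 0"
    and P4: "\<And>j. j \<in> {1..n-1} \<Longrightarrow> \<exists>i\<in>{1..n}. L i j \<noteq> 0"
  shows "differentially_essential n L \<longleftrightarrow> (\<exists>!Q. super_essential_subsystem n f L Q)"
proof
  let ?N = "neighbours n L"
  assume "differentially_essential n L"
  then obtain i where "i \<in> {1..n}" "tau_condition n L i"
    unfolding differentially_essential_def by blast
  then obtain \<eta> where \<eta>: "inj_on \<eta> ({1..n} - {i})" "\<And>j. j \<in> {1..n} - {i} \<Longrightarrow> \<eta> j \<in> ?N j"
    unfolding tau_condition_iff[OF \<open>i \<in> {1..n}\<close>] by blast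
  \<comment> \<open>\<open>\<eta>\<close> matches every row of \<open>X\<close> except possibly
    \<open>i\<close>, so the deficiency is at most 1.\<close>
  have nullity: "card X \<le> card (\<Union>(?N ` X)) + 1" if "X \<subseteq> {1..n}" for X
  proof -
    have "card (X - {i}) \<le> card (\<Union>(?N ` X))"
    proof (rule card_inj_on_le[of \<eta>])
      show "inj_on \<eta> (X - {i})" using that by (intro inj_on_subset[OF \<eta>(1)]) blast
      show "\<eta> ` (X - {i}) \<subseteq> \<Union>(?N ` X)" using that \<eta>(2) by blast
    qed (rule finite_Union_neighbours)
    moreover have "card X \<le> card (X - {i}) + 1"
      by (simp add: card_Diff_singleton_if, linarith)
    ultimately show ?thesis by linarith
  qed
  have "card (\<Union>(?N ` {1..n})) \<le> card {1..n-1}"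
    by (intro card_mono Union_neighbours_subset) simp
  then have "card (\<Union>(?N ` {1..n})) < card {1..n}" using \<open>n \<ge> 2\<close> by simp
  then obtain I where I: "I \<subseteq> {1..n}" "minimal_deficient ?N I"
    using deficient_imp_minimal_deficient[of "{1..n}"] by blast
  have "I' = I" if "I' \<subseteq> {1..n}" "minimal_deficient ?N I'" for I'
  proof (rule minimal_deficient_unique)
    show "finite (I' \<union> I)" using that I by (auto intro: finite_subset)
    show "card (I' \<union> I) \<le> card (\<Union>(?N ` (I' \<union> I))) + 1" using that I by (intro nullity) auto
  qed (use that I finite_Union_neighbours in auto)
  then show "\<exists>!Q. super_essential_subsystem n f L Q"
    unfolding super_essential_subsystem_iff using I by metis
next
  let ?N = "neighbours n L"
  assume "\<exists>!Q. super_essential_subsystem n f L Q"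
  then obtain I where I: "I \<subseteq> {1..n}" "minimal_deficient ?N I"
    and unique: "\<And>I'. I' \<subseteq> {1..n} \<Longrightarrow> minimal_deficient ?N I' \<Longrightarrow> f ` I' = f ` I"
    unfolding super_essential_subsystem_iff by metis
  have "I \<noteq> {}" using I(2) by (auto simp: minimal_deficient_def)
  then obtain h where h: "h \<in> I" by blast
  \<comment> \<open>A deficient set avoiding \<open>h\<close> would contain a minimal one,
    necessarily different from \<open>I\<close>.\<close>
  have hall: "card X \<le> card (\<Union>(?N ` X))" if X: "X \<subseteq> {1..n} - {h}" for X
  proof (rule ccontr)
    assume "\<not> card X \<le> card (\<Union>(?N ` X))"
    moreover have "finite X" using X by (rule finite_subset) simp
    ultimately obtain I' where I': "I' \<subseteq> X" "minimal_deficient ?N I'"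
      using deficient_imp_minimal_deficient[of X ?N] by auto
    have "I' \<subseteq> {1..n}" using I' X by blast
    \<comment> \<open>Uniqueness concerns sets of polynomials; injectivity of \<open>f\<close>
      transfers it to index sets.\<close>
    then have "I' = I"
      using unique[of I'] I' I(1) P2 by (simp add: inj_on_image_eq_iff)
    with h I' X show False by blast
  qed
  have "\<exists>\<eta>. inj_on \<eta> ({1..n} - {h}) \<and> (\<forall>j\<in>{1..n} - {h}. \<eta> j \<in> ?N j)"
    by (rule hall_marriage) (simp_all only: finite_Diff finite_atLeastAtMost finite_neighbours hall)
  moreover have "h \<in> {1..n}" using h I(1) by blast
  ultimately show "differentially_essential n L"
    unfolding differentially_essential_def using tau_condition_iff by blast
qed

end
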